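(* Consider the problem of minimizing $$\sum_{i=1}^n\Bigl(H(g_2(z_i))+h(g_2(z_i))\bigl(L(g_1(z_i),y_i)-g_2(z_i)\bigr)\Bigr)$$ over all pairs $g_1,g_2:\{z_1,\dots,z_n\}\to\mathbb{R}$ with $g_1$ increasing and $g_2$ decreasing. Assume that there exist $\hat g_1,\hat g_2:\{z_1,\dots,z_n\}\to\mathbb{R}$ solving this minimization problem. Then the pair $$\hat g_1^-(\cdot\,;h(\hat g_2)),\qquad \hat g_2^-\bigl(\cdot\,;\hat g_1^-(\cdot\,;h(\hat g_2))\bigr)$$ is also a minimizer.
   Context: A function $V:\mathbb{R}\times\mathbb{R}\to\mathbb{R}$ is an identification function if $V(\cdot,y)$ is increasing and left-continuous for every $y\in\mathbb{R}$. Fix such a $V$. For a probability measure $P$ on $\mathbb{R}$ with finite support write $V(x_1,P)=\int V(x_1,y)\,\mathrm{d}P(y)$. The functional $T$ induced by $V$ is $T(P)=[T^-(P),T^+(P)]\subseteq[-\infty,\infty]$ with $T^-(P)=\sup\{x_1:V(x_1,P)<0\}$ and $T^+(P)=\inf\{x_1:V(x_1,P)>0\}$. $\mathcal{L}$ is the class of (consistent) loss functions $(x_1,y)\mapsto\int_{\mathbb{R}}(\mathbf{1}\{\eta\le x_1\}-\mathbf{1}\{\eta\le y\})V(\eta,y)\,\mathrm{d}H_1(\eta)$ with $H_1$ a positive measure on $\mathbb{R}$. Fix $L\in\mathcal{L}$. Observations $(z_1,y_1),\dots,(z_n,y_n)$ are given with $y_i\in\mathbb{R}$ and totally ordered covariates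 $z_1<\dots<z_n$. The function $h:\mathbb{R}\to(0,\infty)$ is decreasing with $\lim_{x\to\infty}h(x)=0$, and $H(r)=\int_0^r h(x)\,\mathrm{d}x$. "Increasing" and "decreasing" are meant in the non-strict sense. For weights $w=(w_1,\dots,w_n)$ define $$\hat g_1^-(z_\ell;w)=\min_{j\ge\ell}\max_{i\le j}T^-(P^w_{i:j})=\max_{i\le\ell}\min_{j\ge i}T^-(P^w_{i:j}),$$ where $P^w_{i:j}$ is the weighted empirical distribution of $y_i,\dots,y_j$ with weights proportional to $w_i,\dots,w_j$; $h(\hat g_2)$ stands for the weights $w_i=h(\hat g_2(z_i))$. For a function $g_1:\{z_1,\dots,z_n\}\to\mathbb{R}$ define $$\hat g_2^-(z_\ell;g_1)=-\min_{j\ge\ell}\max_{i\le j}-\mathbb{E}(\bar P_{i:j})=-\max_{i\le\ell}\min_{j\ge i}-\mathbb{E}(\bar P_{i:j}),$$ where $\bar P_{i:j}$ is the empirical distribution of $L(g_1(z_i),y_i),\dots,L(g_1(z_j),y_j)$ and $\mathbb{E}(P)$ denotes the mean of $P$. Indices $i,j,\ell$ range over $\{1,\dots,n\}$.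
   Formalization: ĝ₁⁻ can be ±∞ (e.g. V=1, H₁=0), where the claim is undefined; the loss formula is then read at x₁=±∞, and "minimizer" means monotone with objective at most that of every real-valued admissible pair. For real-valued ĝ₁⁻ the claim is unchanged. *)

theory Defs
  imports "HOL-Probability.Probability"
begin

definition identification_function :: "(real \<Rightarrow> real \<Rightarrow> real) \<Rightarrow> bool" where
  "identification_function V \<longleftrightarrow>
     (\<forall>y. mono (\<lambda>x. V x y) \<and> (\<forall>x. continuous (at_left x) (\<lambda>x. V x y)))"

definition T_lower :: "(real \<Rightarrow> real \<Rightarrow> real) \<Rightarrow> real pmf \<Rightarrow> ereal" where
  "T_lower V P = Sup (ereal ` {x. measure_pmf.expectation P (V x) < 0})"

text \<open>The first argument of a loss may be infinite, because the functional \<open>T_lower\<close> takes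
  values in \<open>[-\<infinity>, \<infinity>]\<close>: for \<open>x = -\<infinity>\<close> the first indicator is identically 0,
  for \<open>x = \<infinity>\<close> it is identically 1.\<close>

definition loss_integrand :: "(real \<Rightarrow> real \<Rightarrow> real) \<Rightarrow> ereal \<Rightarrow> real \<Rightarrow> real \<Rightarrow> real" where
  "loss_integrand V x y \<eta> = (of_bool (ereal \<eta> \<le> x) - of_bool (\<eta> \<le> y)) * V \<eta> y"

text \<open>The measure \<open>H1\<close> is an arbitrary Borel measure for which the loss is a well-defined
  function on \<open>\<real> \<times> \<real>\<close>; integrability is not required at \<open>x = \<plusminus>\<infinity>\<close>.\<close>

definition consistent_losses :: "(real \<Rightarrow> real \<Rightarrow> real) \<Rightarrow> (ereal \<Rightarrow> real \<Rightarrow> real) set" where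
  "consistent_losses V = {L. \<exists>H1 :: real measure. sets H1 = sets borel \<and>
     (\<forall>(x::real) y. integrable H1 (loss_integrand V (ereal x) y)) \<and>
     (\<forall>x y. L x y = (\<integral>\<eta>. loss_integrand V x y \<eta> \<partial>H1))}"

definition weighted_empirical :: "(nat \<Rightarrow> real) \<Rightarrow> (nat \<Rightarrow> real) \<Rightarrow> nat \<Rightarrow> nat \<Rightarrow> real pmf" where
  "weighted_empirical w y i j =
     map_pmf y (embed_pmf (\<lambda>k. if k \<in> {i..j} then w k / (\<Sum>m=i..j. w m) else 0))"

definition empirical :: "(nat \<Rightarrow> real) \<Rightarrow> nat \<Rightarrow> nat \<Rightarrow> real pmf" where
  "empirical v i j = map_pmf v (pmf_of_set {i..j})"

text \<open>The next two functions are meaningful at the covariates: for \<open>x = z l\<close> with \<open>z\<close>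
  strictly increasing, the outer minimum runs over \<open>j = l, \<dots>, n\<close>.\<close>

definition g1_lower ::
  "(real \<Rightarrow> real \<Rightarrow> real) \<Rightarrow> nat \<Rightarrow> (nat \<Rightarrow> 'z::linorder) \<Rightarrow> (nat \<Rightarrow> real) \<Rightarrow> (nat \<Rightarrow> real) \<Rightarrow> 'z \<Rightarrow> ereal"
  where
  "g1_lower V n z y w x =
     (MIN j\<in>{j \<in> {1..n}. x \<le> z j}. MAX i\<in>{1..j}. T_lower V (weighted_empirical w y i j))"

definition g2_lower ::
  "(ereal \<Rightarrow> real \<Rightarrow> real) \<Rightarrow> nat \<Rightarrow> (nat \<Rightarrow> 'z::linorder) \<Rightarrow> (nat \<Rightarrow> real) \<Rightarrow> ('z \<Rightarrow> ereal) \<Rightarrow> 'z \<Rightarrow> real"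
  where
  "g2_lower L n z y g1 x =
     - (MIN j\<in>{j \<in> {1..n}. x \<le> z j}. MAX i\<in>{1..j}.
          - measure_pmf.expectation (empirical (\<lambda>k. L (g1 (z k)) (y k)) i j) (\<lambda>v. v))"

text \<open>The interval integral is oriented, so this is the usual signed integral also for \<open>r < 0\<close>.\<close>

definition antiderivative :: "(real \<Rightarrow> real) \<Rightarrow> real \<Rightarrow> real" where
  "antiderivative h r = (LBINT x=ereal 0..ereal r. h x)"

definition objective ::
  "(real \<Rightarrow> real) \<Rightarrow> (ereal \<Rightarrow> real \<Rightarrow> real) \<Rightarrow> nat \<Rightarrow> (nat \<Rightarrow> 'z) \<Rightarrow> (nat \<Rightarrow> real)
     \<Rightarrow> ('z \<Rightarrow> ereal) \<Rightarrow> ('z \<Rightarrow> real) \<Rightarrow> real" where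
  "objective h L n z y g1 g2 =
     (\<Sum>i=1..n. antiderivative h (g2 (z i)) + h (g2 (z i)) * (L (g1 (z i)) (y i) - g2 (z i)))"

text \<open>The competitors are real-valued. For real-valued \<open>g1\<close> this is minimality in the usual
  sense; an extended-valued \<open>g1\<close> is called a minimizer if it does at least as well as every
  real-valued competitor.\<close>

definition is_minimizer ::
  "(real \<Rightarrow> real) \<Rightarrow> (ereal \<Rightarrow> real \<Rightarrow> real) \<Rightarrow> nat \<Rightarrow> (nat \<Rightarrow> 'z::linorder) \<Rightarrow> (nat \<Rightarrow> real)
     \<Rightarrow> ('z \<Rightarrow> ereal) \<Rightarrow> ('z \<Rightarrow> real) \<Rightarrow> bool" where
  "is_minimizer h L n z y g1 g2 \<longleftrightarrow>
     mono_on (z ` {1..n}) g1 \<and> antimono_on (z ` {1..n}) g2 \<and>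
     (\<forall>(f1 :: 'z \<Rightarrow> real) (f2 :: 'z \<Rightarrow> real).
        mono_on (z ` {1..n}) f1 \<longrightarrow> antimono_on (z ` {1..n}) f2 \<longrightarrow>
        objective h L n z y g1 g2 \<le> objective h L n z y (\<lambda>x. ereal (f1 x)) f2)"

end

theory Submission imports Defs begin

text \<open>
  The two coordinates can be optimised one after the other, because each half-problem has an
  explicit min-max solution. Let \<open>w k = h (g2_hat (z k))\<close>, and write \<open>g1\<close>, \<open>g2\<close> for the two
  min-max functions of the conclusion. The claim is the chain
  \<open>objective g1 g2 \<le> objective g1 g2_hat \<le> objective g1_hat g2_hat\<close>.

  For the first inequality, let \<open>v k\<close> be the loss of \<open>g1\<close> at the \<open>k\<close>-th observation. The
  antiderivative \<open>H\<close> of \<open>h\<close> is concave and \<open>h\<close> is a supergradient of it, so replacing \<open>g2\<close> by a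
  decreasing \<open>r\<close> changes the objective by at least \<open>\<Sum>k. (h (r k) - h (g2 k)) * (v k - g2 k)\<close>. The
  sums of the residuals \<open>v k - g2 k\<close> over final segments of the indices are nonnegative and vanish
  where a block of constancy of \<open>g2\<close> starts (\<open>minmax_mean_tail_sums\<close>), so that summation by parts
  shows this change to be nonnegative (\<open>minmax_mean_optimal\<close>).

  For the second inequality only \<open>\<Sum>k. w k * L (g1 k) (y k)\<close> matters. The loss is an integral over
  thresholds \<open>\<eta>\<close>, and the min-max function is optimal for every single threshold
  (\<open>minmax_pointwise_optimal\<close>): its superlevel set at \<open>\<eta>\<close> minimises \<open>\<Sum>k. w k * V \<eta> (y k)\<close> over all
  final segments. Integrating this inequality gives the claim (\<open>minmax_T_lower_optimal\<close>).

  The integration is legitimate only if the losses at \<open>g1\<close> are genuine integrals, and \<open>g1\<close> may be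
  infinite. Here the existence of a real-valued minimiser enters (\<open>integrable_at_minmax\<close>).
  Where \<open>g1 = \<infinity>\<close>, raising \<open>g1_hat\<close> lowers the loss at every threshold above the value of
  \<open>g1_hat\<close> at the start of that block, so optimality of \<open>g1_hat\<close> leaves no mass of the measure there.
  Where \<open>g1 = -\<infinity>\<close>, lowering \<open>g1_hat\<close> may be merely neutral, with losses of opposite signs
  diverging and cancelling in the weighted sum. Such a cancellation would be exploited by changing
  the weights, that is by raising \<open>g2_hat\<close> on an initial segment; as \<open>h\<close> tends to \<open>0\<close>, a
  level \<open>R\<close> with \<open>h R\<close> below all weights exists, and the minimality of the pair then bounds
  each loss separately (\<open>bounded_of_weighted_prefix_bounds\<close>).
\<close>

section \<open>Min-max functions of block functionals\<close>

definition minmax :: "nat \<Rightarrow> (nat \<Rightarrow> nat \<Rightarrow> 'a::linorder) \<Rightarrow> nat \<Rightarrow> 'a" where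
  "minmax n T l = (MIN j\<in>{l..n}. MAX i\<in>{1..j}. T i j)"

text \<open>The Cauchy mean value property: the value on a block lies between the values on the two
  parts of any splitting. It is what makes min-max and max-min over blocks agree.\<close>

definition cauchy_mean :: "nat \<Rightarrow> (nat \<Rightarrow> nat \<Rightarrow> 'a::linorder) \<Rightarrow> bool" where
  "cauchy_mean n T \<longleftrightarrow> (\<forall>i k j. 1 \<le> i \<longrightarrow> i \<le> k \<longrightarrow> k < j \<longrightarrow> j \<le> n \<longrightarrow>
     min (T i k) (T (Suc k) j) \<le> T i j \<and> T i j \<le> max (T i k) (T (Suc k) j))"

lemma minmax_le:
  assumes "l \<le> j" "j \<le> n"
  shows "minmax n T l \<le> (MAX i\<in>{1..j}. T i j)"
  unfolding minmax_def using assms by (intro Min_le) auto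

lemma minmax_attained:
  assumes "l \<le> n"
  obtains j where "l \<le> j" "j \<le> n" "minmax n T l = (MAX i\<in>{1..j}. T i j)"
proof -
  have "minmax n T l \<in> (\<lambda>j. MAX i\<in>{1..j}. T i j) ` {l..n}"
    unfolding minmax_def using assms by (intro Min_in) auto
  then show ?thesis using that by auto
qed

lemma minmax_mono:
  assumes "l \<le> l'" "l' \<le> n"
  shows "minmax n T l \<le> minmax n T l'"
  by (rule minmax_attained[OF assms(2), of T]) (use assms minmax_le[of l _ n T] in auto)

text \<open>If the min-max function jumps after \<open>q\<close>, then the outer minimum at \<open>q\<close> is attained at
  \<open>j = q\<close>: any larger \<open>j\<close> also competes in the minimum at \<open>Suc q\<close>.\<close>

lemma minmax_block_end:
  assumes "1 \<le> i" "i \<le> q" "q \<le> n" and jump: "q < n \<Longrightarrow> minmax n T q < minmax n T (Suc q)"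
  shows "T i q \<le> minmax n T q"
proof -
  obtain j where j: "q \<le> j" "j \<le> n" "minmax n T q = (MAX i\<in>{1..j}. T i j)"
    using minmax_attained[OF assms(3)] .
  have "\<not> q < j"
  proof
    assume "q < j"
    then have "minmax n T (Suc q) \<le> minmax n T q" unfolding j(3) using j \<open>q < j\<close> by (intro minmax_le) auto
    moreover have "minmax n T q < minmax n T (Suc q)" using jump \<open>q < j\<close> j(2) by linarith
    ultimately show False by (simp add: leD)
  qed
  then have "j = q" using j by simp
  then show ?thesis using j assms by (auto intro!: Max_ge)
qed

text \<open>The dual statement for the start of a block, where the mean value property is essential.
  For each \<open>j\<close> some \<open>T i j\<close> reaches the level \<open>minmax n T p\<close>. If \<open>i < p\<close>, the part
  before \<open>p\<close> lies below that level by \<open>minmax_block_end\<close>, so the part from \<open>p\<close> on must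
  reach it; if \<open>p < i\<close>, the part before \<open>i\<close> reaches it by induction.\<close>

lemma minmax_block_start:
  assumes T: "cauchy_mean n T"
    and "1 \<le> p" "p \<le> j" "j \<le> n"
    and jump: "1 < p \<Longrightarrow> minmax n T (p - 1) < minmax n T p"
  shows "minmax n T p \<le> T p j"
  using assms(3,4)
proof (induction j rule: less_induct)
  case (less j)
  have "(MAX i\<in>{1..j}. T i j) \<in> (\<lambda>i. T i j) ` {1..j}"
    using less.prems assms(2) by (intro Max_in) auto
  then obtain i where i: "1 \<le> i" "i \<le> j" "(MAX i\<in>{1..j}. T i j) = T i j" by auto
  have ge: "minmax n T p \<le> T i j"
    using minmax_le[of p j n T] less.prems i by auto
  consider "i < p" | "i = p" | "p < i" by linarith
  then show ?case
  proof cases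
    case 1
    have "T i (p - 1) \<le> minmax n T (p - 1)"
      using 1 i less.prems jump by (intro minmax_block_end) auto
    then have lt: "T i (p - 1) < minmax n T p" using jump 1 i by auto
    have "T i j \<le> max (T i (p - 1)) (T (Suc (p - 1)) j)"
      using T[unfolded cauchy_mean_def, rule_format, of i "p - 1" j] 1 i less.prems assms(2) by auto
    then have "T i j \<le> max (T i (p - 1)) (T p j)" using assms(2) by simp
    then show ?thesis using lt ge by (auto simp: le_max_iff_disj)
  next
    case 2 then show ?thesis using ge by simp
  next
    case 3
    have "min (T p (i - 1)) (T (Suc (i - 1)) j) \<le> T p j"
      using T[unfolded cauchy_mean_def, rule_format, of p "i - 1" j] 3 i less.prems assms(2) by auto
    moreover have "minmax n T p \<le> T p (i - 1)" using 3 i less.prems by (intro less.IH) auto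
    moreover have "Suc (i - 1) = i" using i by simp
    ultimately show ?thesis using ge by (auto simp: min_le_iff_disj)
  qed
qed

lemma sum_split_at:
  fixes f :: "nat \<Rightarrow> 'a::comm_monoid_add"
  assumes "i \<le> Suc k" "k \<le> j"
  shows "sum f {i..j} = sum f {i..k} + sum f {Suc k..j}"
proof -
  have "{i..j} = {i..k} \<union> {Suc k..j}" using assms by auto
  then show ?thesis by (simp add: sum.union_disjoint)
qed

lemma upper_set_of_mono:
  fixes f :: "nat \<Rightarrow> 'a::linorder"
  assumes "mono_on {1..n} f"
  obtains u where "1 \<le> u" "u \<le> Suc n" "\<And>k. k \<in> {1..n} \<Longrightarrow> c \<le> f k \<longleftrightarrow> u \<le> k"
proof (cases "\<exists>k\<in>{1..n}. c \<le> f k")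
  case True
  define u where "u = (LEAST k. k \<in> {1..n} \<and> c \<le> f k)"
  have u: "u \<in> {1..n} \<and> c \<le> f u"
    unfolding u_def by (rule LeastI_ex) (use True in auto)
  have "c \<le> f k \<longleftrightarrow> u \<le> k" if "k \<in> {1..n}" for k
  proof
    assume "c \<le> f k" then show "u \<le> k" unfolding u_def using that by (intro Least_le) auto
  next
    assume "u \<le> k"
    then show "c \<le> f k" using u that monotone_onD[OF assms, of u k] by auto
  qed
  then show ?thesis using u that by auto
next
  case False
  then show ?thesis using that[of "Suc n"] by auto
qed

text \<open>Among all final segments, the superlevel set \<open>{u..n}\<close> of the min-max function at \<open>\<eta>\<close> has the
  smallest sum of \<open>a\<close>. Shrinking it removes a block that starts at \<open>u\<close>, whose sum is nonpositive
  by \<open>minmax_block_start\<close>; enlarging it adds a block that ends at \<open>u - 1\<close>, whose sum is nonnegative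
  by \<open>minmax_block_end\<close>.\<close>

lemma minmax_pointwise_optimal:
  fixes T :: "nat \<Rightarrow> nat \<Rightarrow> ereal" and a f :: "nat \<Rightarrow> real"
  assumes T: "cauchy_mean n T"
    and nonpos: "\<And>i j. 1 \<le> i \<Longrightarrow> i \<le> j \<Longrightarrow> j \<le> n \<Longrightarrow> ereal \<eta> \<le> T i j \<Longrightarrow> sum a {i..j} \<le> 0"
    and nonneg: "\<And>i j. 1 \<le> i \<Longrightarrow> i \<le> j \<Longrightarrow> j \<le> n \<Longrightarrow> T i j < ereal \<eta> \<Longrightarrow> 0 \<le> sum a {i..j}"
    and f: "mono_on {1..n} f"
  shows "(\<Sum>k=1..n. of_bool (ereal \<eta> \<le> minmax n T k) * a k) \<le> (\<Sum>k=1..n. of_bool (\<eta> \<le> f k) * a k)"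
proof -
  have "mono_on {1..n} (minmax n T)" by (auto intro!: mono_onI minmax_mono)
  then obtain u where u: "1 \<le> u" "u \<le> Suc n"
    "\<And>k. k \<in> {1..n} \<Longrightarrow> ereal \<eta> \<le> minmax n T k \<longleftrightarrow> u \<le> k"
    using upper_set_of_mono[of n "minmax n T" "ereal \<eta>"] by blast
  obtain v where v: "1 \<le> v" "v \<le> Suc n" "\<And>k. k \<in> {1..n} \<Longrightarrow> \<eta> \<le> f k \<longleftrightarrow> v \<le> k"
    using upper_set_of_mono[OF f, of \<eta>] by blast
  have sums: "(\<Sum>k=1..n. of_bool (P k) * a k) = sum a {q..n}"
    if "1 \<le> q" "\<And>k. k \<in> {1..n} \<Longrightarrow> P k \<longleftrightarrow> q \<le> k" for P and q :: nat
  proof -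
    have "(\<Sum>k=1..n. of_bool (P k) * a k) = (\<Sum>k=1..n. if q \<le> k then a k else 0)"
      using that by (intro sum.cong) auto
    also have "\<dots> = sum a ({1..n} \<inter> {k. q \<le> k})" by (simp add: sum.inter_restrict)
    also have "{1..n} \<inter> {k. q \<le> k} = {q..n}" using that by auto
    finally show ?thesis .
  qed
  have "sum a {u..n} \<le> sum a {v..n}"
  proof -
    consider "u = v" | "u < v" | "v < u" by linarith
    then show ?thesis
    proof cases
      case 2
      have gu: "ereal \<eta> \<le> minmax n T u" using u 2 v by auto
      have "minmax n T u \<le> T u (v - 1)"
      proof (intro minmax_block_start T)
        assume "1 < u"
        then have "\<not> ereal \<eta> \<le> minmax n T (u - 1)" using u(3)[of "u - 1"] u(2) by force
        then show "minmax n T (u - 1) < minmax n T u" using gu by auto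
      qed (use 2 u v in auto)
      then have "ereal \<eta> \<le> T u (v - 1)" using gu by (rule order_trans[rotated])
      then have "sum a {u..v - 1} \<le> 0" using 2 u v by (intro nonpos) auto
      moreover have "sum a {u..n} = sum a {u..v - 1} + sum a {v..n}"
        using sum_split_at[of u "v - 1" n a] 2 v u by auto
      ultimately show ?thesis by simp
    next
      case 3
      have gu: "minmax n T (u - 1) < ereal \<eta>" using u(3)[of "u - 1"] u(2) 3 v by force
      have "T v (u - 1) \<le> minmax n T (u - 1)"
      proof (intro minmax_block_end)
        assume "u - 1 < n"
        then have "ereal \<eta> \<le> minmax n T u" using u 3 by auto
        then show "minmax n T (u - 1) < minmax n T (Suc (u - 1))" using gu 3 by auto
      qed (use 3 u v in auto)
      then have "0 \<le> sum a {v..u - 1}" using gu 3 u v by (intro nonneg) auto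
      moreover have "sum a {v..n} = sum a {v..u - 1} + sum a {u..n}"
        using sum_split_at[of v "u - 1" n a] 3 v u by auto
      ultimately show ?thesis by simp
    qed simp
  qed
  then show ?thesis using sums[OF u(1,3)] sums[OF v(1,3)] by simp
qed

section \<open>The functional induced by an identification function\<close>

definition block_sum :: "(real \<Rightarrow> real \<Rightarrow> real) \<Rightarrow> (nat \<Rightarrow> real) \<Rightarrow> (nat \<Rightarrow> real) \<Rightarrow> nat \<Rightarrow> nat \<Rightarrow> real \<Rightarrow> real"
  where "block_sum V w y i j x = (\<Sum>k=i..j. w k * V x (y k))"

lemma expectation_weighted_empirical:
  assumes "\<And>k. 0 < w k" "i \<le> j"
  shows "measure_pmf.expectation (weighted_empirical w y i j) f
    = (\<Sum>k=i..j. w k * f (y k)) / (\<Sum>m=i..j. w m)"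
proof -
  define W where "W = (\<Sum>m=i..j. w m)"
  have W: "0 < W" unfolding W_def using assms by (intro sum_pos) auto
  let ?f = "\<lambda>k. if k \<in> {i..j} then w k / W else 0"
  have nn: "\<And>k. 0 \<le> ?f k" using W assms by (auto intro: less_imp_le)
  have "(\<integral>\<^sup>+k. ennreal (?f k) \<partial>count_space UNIV) = (\<Sum>k\<in>{i..j}. ennreal (?f k))"
    by (subst nn_integral_count_space'[of "{i..j}"]) auto
  also have "\<dots> = ennreal (\<Sum>k\<in>{i..j}. ?f k)" by (intro sum_ennreal nn)
  also have "(\<Sum>k\<in>{i..j}. ?f k) = 1"
    using W by (simp add: sum_divide_distrib[symmetric] flip: W_def)
  finally have one: "(\<integral>\<^sup>+k. ennreal (?f k) \<partial>count_space UNIV) = 1" by simp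
  have pmf: "pmf (embed_pmf ?f) k = ?f k" for k by (rule pmf_embed_pmf[OF nn one])
  have set: "set_pmf (embed_pmf ?f) \<subseteq> {i..j}" unfolding set_pmf_eq pmf by auto
  have "measure_pmf.expectation (weighted_empirical w y i j) f
      = measure_pmf.expectation (embed_pmf ?f) (\<lambda>k. f (y k))"
    unfolding weighted_empirical_def W_def by simp
  also have "\<dots> = (\<Sum>k\<in>{i..j}. pmf (embed_pmf ?f) k * f (y k))"
    by (subst integral_measure_pmf[of "{i..j}"]) (use set in auto)
  also have "\<dots> = (\<Sum>k=i..j. w k * f (y k)) / W"
    unfolding pmf sum_divide_distrib by (intro sum.cong) auto
  finally show ?thesis by (simp add: W_def)
qed

text \<open>Normalising the weights does not change the sign of the integral, so \<open>T_lower\<close> is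
  the level at which the weighted block sum stops being negative.\<close>

lemma T_lower_weighted_empirical:
  assumes "\<And>k. 0 < w k" "i \<le> j"
  shows "T_lower V (weighted_empirical w y i j) = Sup (ereal ` {x. block_sum V w y i j x < 0})"
proof -
  have "0 < (\<Sum>m=i..j. w m)" using assms by (intro sum_pos) auto
  then have "measure_pmf.expectation (weighted_empirical w y i j) (V x) < 0
      \<longleftrightarrow> block_sum V w y i j x < 0" for x
    using expectation_weighted_empirical[OF assms, where y = y and f = "V x"]
    by (simp add: divide_less_0_iff block_sum_def)
  then show ?thesis unfolding T_lower_def by simp
qed

lemma block_sum_mono:
  assumes "identification_function V" "\<And>k. 0 < w k" "x \<le> x'"
  shows "block_sum V w y i j x \<le> block_sum V w y i j x'"
  unfolding block_sum_def using assms
  by (intro sum_mono mult_left_mono) (auto simp: identification_function_def mono_def less_imp_le)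

lemma T_lower_gt_imp_neg:
  assumes "identification_function V" "\<And>k. 0 < w k" "i \<le> j"
    and "ereal x < T_lower V (weighted_empirical w y i j)"
  shows "block_sum V w y i j x < 0"
proof -
  obtain x' where "x < x'" "block_sum V w y i j x' < 0"
    using assms(4) unfolding T_lower_weighted_empirical[OF assms(2,3)] less_Sup_iff by auto
  then show ?thesis using block_sum_mono[OF assms(1,2), of x x'] by (meson le_less_trans less_imp_le)
qed

lemma T_lower_lt_imp_nonneg:
  assumes "\<And>k. 0 < w k" "i \<le> j" "T_lower V (weighted_empirical w y i j) < ereal x"
  shows "0 \<le> block_sum V w y i j x"
proof (rule ccontr)
  assume "\<not> ?thesis"
  then have "ereal x \<le> T_lower V (weighted_empirical w y i j)"
    unfolding T_lower_weighted_empirical[OF assms(1,2)] by (intro Sup_upper) auto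
  then show False using assms(3) by simp
qed

text \<open>The weak form at \<open>x\<close> itself is where left-continuity of the identification function is used.\<close>

lemma T_lower_ge_imp_nonpos:
  assumes V: "identification_function V" and w: "\<And>k. 0 < w k" and "i \<le> j"
    and ge: "ereal x \<le> T_lower V (weighted_empirical w y i j)"
  shows "block_sum V w y i j x \<le> 0"
proof (rule tendsto_upperbound)
  show "((\<lambda>x. block_sum V w y i j x) \<longlongrightarrow> block_sum V w y i j x) (at_left x)"
    unfolding block_sum_def using V
    by (intro tendsto_intros) (auto simp: identification_function_def continuous_within)
  show "eventually (\<lambda>t. block_sum V w y i j t \<le> 0) (at_left x)"
    unfolding eventually_at_filter
  proof (intro always_eventually allI impI)
    fix t assume "t \<in> {..<x}"
    then have "ereal t < T_lower V (weighted_empirical w y i j)"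
      using ge by (intro less_le_trans[OF _ ge]) auto
    then show "block_sum V w y i j t \<le> 0"
      by (intro less_imp_le T_lower_gt_imp_neg[OF V w \<open>i \<le> j\<close>])
  qed
qed simp

lemma cauchy_mean_T_lower:
  assumes V: "identification_function V" and w: "\<And>k. 0 < w k"
  shows "cauchy_mean n (\<lambda>i j. T_lower V (weighted_empirical w y i j))"
  unfolding cauchy_mean_def
proof (intro allI impI conjI)
  fix i k j :: nat
  assume ik: "i \<le> k" and kj: "k < j"
  let ?T = "\<lambda>i j. T_lower V (weighted_empirical w y i j)"
  have split: "block_sum V w y i j x = block_sum V w y i k x + block_sum V w y (Suc k) j x" for x
    unfolding block_sum_def using ik kj by (intro sum_split_at) auto
  show "min (?T i k) (?T (Suc k) j) \<le> ?T i j"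
  proof (rule ccontr)
    assume "\<not> ?thesis"
    then obtain x where x: "?T i j < ereal x" "ereal x < min (?T i k) (?T (Suc k) j)"
      using ereal_dense2 by (meson not_le)
    then have "block_sum V w y i k x < 0" "block_sum V w y (Suc k) j x < 0"
      using T_lower_gt_imp_neg[OF V w] ik kj by auto
    then show False using T_lower_lt_imp_nonneg[where w = w and i = i and j = j and V = V and y = y and x = x, OF w] x split[of x] ik kj by auto
  qed
  show "?T i j \<le> max (?T i k) (?T (Suc k) j)"
  proof (rule ccontr)
    assume "\<not> ?thesis"
    then obtain x where x: "max (?T i k) (?T (Suc k) j) < ereal x" "ereal x < ?T i j"
      using ereal_dense2 by (meson not_le)
    then have "0 \<le> block_sum V w y i k x" "0 \<le> block_sum V w y (Suc k) j x"
      using T_lower_lt_imp_nonneg[OF w] ik kj by auto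
    then show False using T_lower_gt_imp_neg[where w = w and i = i and j = j and y = y and x = x, OF V w] x split[of x] ik kj by auto
  qed
qed

section \<open>Antitonic regression of the mean\<close>

lemma antiderivative_diff_bounds:
  assumes h: "antimono h" and "a \<le> b"
  shows "h b * (b - a) \<le> antiderivative h b - antiderivative h a"
    and "antiderivative h b - antiderivative h a \<le> h a * (b - a)"
proof -
  have "mono (\<lambda>x. - h x)" using h by (auto simp: monotone_def)
  then have meas: "h \<in> borel_measurable borel"
    using borel_measurable_mono[of "\<lambda>x. - h x"] by (simp add: borel_measurable_uminus_eq)
  have int: "set_integrable lborel {a..b} h" for a b
  proof (cases "a \<le> b")
    case True
    show ?thesis unfolding set_integrable_def
    proof (rule Bochner_Integration.integrable_bound[of _ "\<lambda>x. indicator {a..b} x * (\<bar>h a\<bar> + \<bar>h b\<bar>)"])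
      show "integrable lborel (\<lambda>x. indicator {a..b} x * (\<bar>h a\<bar> + \<bar>h b\<bar>))"
        by (intro integrable_mult_left integrable_real_indicator) (auto simp: True)
      show "AE x in lborel. norm (indicator {a..b} x *\<^sub>R h x) \<le> norm (indicator {a..b} x * (\<bar>h a\<bar> + \<bar>h b\<bar>))"
      proof (intro always_eventually allI)
        fix x
        show "norm (indicator {a..b} x *\<^sub>R h x) \<le> norm (indicator {a..b} x * (\<bar>h a\<bar> + \<bar>h b\<bar>))"
          using antimonoD[OF h, of a x] antimonoD[OF h, of x b] by (auto simp: indicator_def)
      qed
    qed (use meas in measurable)
  qed (simp add: set_integrable_def)
  have int': "set_integrable lborel {a<..<b} h" for a b
    by (rule set_integrable_subset[OF int[of a b]]) auto
  have ii: "interval_lebesgue_integrable lborel (ereal a) (ereal b) h" for a b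
    unfolding interval_lebesgue_integrable_def using int'[of a b] int'[of b a] by simp
  have "antiderivative h a + (LBINT x=ereal a..ereal b. h x) = antiderivative h b"
    unfolding antiderivative_def
  proof (rule interval_integral_sum)
    show "interval_lebesgue_integrable lborel (min (ereal 0) (min (ereal a) (ereal b)))
        (max (ereal 0) (max (ereal a) (ereal b))) h"
      using ii[of "min 0 (min a b)" "max 0 (max a b)"] by (simp only: ereal_min ereal_max)
  qed
  then have diff: "antiderivative h b - antiderivative h a = (LBINT x:{a..b}. h x)"
    using interval_integral_Icc[OF \<open>a \<le> b\<close>, of h] by linarith
  have const: "(LBINT x:{a..b}. c) = c * (b - a)" for c :: real
    using interval_integral_Icc[OF \<open>a \<le> b\<close>, of "\<lambda>x. c"] interval_integral_const(2)[of a b c] by linarith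
  have ic: "set_integrable lborel {a..b} (\<lambda>x. c)" for c :: real
    by (rule borel_integrable_atLeastAtMost') simp
  have "(LBINT x:{a..b}. h b) \<le> (LBINT x:{a..b}. h x)"
    by (rule set_integral_mono[OF ic int]) (use h in \<open>auto simp: monotone_def\<close>)
  then show "h b * (b - a) \<le> antiderivative h b - antiderivative h a"
    unfolding diff const .
  have "(LBINT x:{a..b}. h x) \<le> (LBINT x:{a..b}. h a)"
    by (rule set_integral_mono[OF int ic]) (use h in \<open>auto simp: monotone_def\<close>)
  then show "antiderivative h b - antiderivative h a \<le> h a * (b - a)"
    unfolding diff const .
qed

lemma antiderivative_supergradient:
  assumes "antimono h"
  shows "antiderivative h s \<le> antiderivative h r + h r * (s - r)"
proof (cases "r \<le> s")
  case True then show ?thesis using antiderivative_diff_bounds(2)[OF assms, of r s] by simp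
next
  case False
  then show ?thesis using antiderivative_diff_bounds(1)[OF assms, of s r] by (simp add: algebra_simps)
qed

definition total_score :: "(real \<Rightarrow> real) \<Rightarrow> nat \<Rightarrow> (nat \<Rightarrow> real) \<Rightarrow> (nat \<Rightarrow> real) \<Rightarrow> real" where
  "total_score h n v r = (\<Sum>k=1..n. antiderivative h (r k) + h (r k) * (v k - r k))"

definition block_mean :: "(nat \<Rightarrow> real) \<Rightarrow> nat \<Rightarrow> nat \<Rightarrow> real" where
  "block_mean v i j = (\<Sum>k=i..j. v k) / real (card {i..j})"

lemma sum_shift_block_mean:
  assumes "i \<le> j"
  shows "(\<Sum>k=i..j. x + v k) = real (card {i..j}) * (x + block_mean v i j)"
  using assms by (simp add: block_mean_def sum.distrib field_simps)

lemma neg_block_mean_le_iff: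
  assumes "i \<le> j"
  shows "- block_mean v i j \<le> x \<longleftrightarrow> 0 \<le> (\<Sum>k=i..j. x + v k)"
    and "x \<le> - block_mean v i j \<longleftrightarrow> (\<Sum>k=i..j. x + v k) \<le> 0"
  unfolding sum_shift_block_mean[OF assms] using assms
  by (auto simp: zero_le_mult_iff mult_le_0_iff)

lemma cauchy_mean_neg_block_mean: "cauchy_mean n (\<lambda>i j. - block_mean v i j)"
  unfolding cauchy_mean_def
proof (intro allI impI conjI)
  fix i k j :: nat
  assume ik: "i \<le> k" and kj: "k < j"
  let ?T = "\<lambda>i j. - block_mean v i j"
  have split: "(\<Sum>k=i..j. x + v k) = (\<Sum>k=i..k. x + v k) + (\<Sum>k=Suc k..j. x + v k)" for x
    using ik kj by (intro sum_split_at) auto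
  let ?M = "max (?T i k) (?T (Suc k) j)" and ?m = "min (?T i k) (?T (Suc k) j)"
  have "0 \<le> (\<Sum>k=i..k. ?M + v k)" "0 \<le> (\<Sum>k=Suc k..j. ?M + v k)"
    using ik kj by (auto simp flip: neg_block_mean_le_iff(1))
  then show "?T i j \<le> ?M"
    using split[of ?M] ik kj by (subst neg_block_mean_le_iff(1)) auto
  have "(\<Sum>k=i..k. ?m + v k) \<le> 0" "(\<Sum>k=Suc k..j. ?m + v k) \<le> 0"
    using ik kj by (auto simp flip: neg_block_mean_le_iff(2))
  then show "?m \<le> ?T i j"
    using split[of ?m] ik kj by (subst neg_block_mean_le_iff(2)) auto
qed

text \<open>The optimality conditions of antitonic regression, for \<open>- g\<close> in place of the regression
  function. They follow block by block from the right end: the residuals of a block of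
  constancy of \<open>g\<close> sum to zero, and over the final part of a block their sum is nonnegative.\<close>

lemma minmax_mean_tail_sums:
  fixes v :: "nat \<Rightarrow> real" and n :: nat
  defines "g \<equiv> minmax n (\<lambda>i j. - block_mean v i j)"
  assumes "1 \<le> p" "p \<le> Suc n"
  shows "0 \<le> (\<Sum>k=p..n. v k + g k) \<and>
    (p = Suc n \<or> (1 < p \<longrightarrow> g (p - 1) < g p) \<longrightarrow> (\<Sum>k=p..n. v k + g k) = 0)"
  using assms(2,3)
proof (induction "Suc n - p" arbitrary: p rule: less_induct)
  case less
  let ?T = "\<lambda>i j. - block_mean v i j"
  show ?case
  proof (cases "p = Suc n")
    case False
    then have p: "1 \<le> p" "p \<le> n" using less.prems by auto
    have gm: "g k \<le> g k'" if "k \<le> k'" "k' \<le> n" for k k' unfolding g_def using that by (rule minmax_mono)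
    \<comment> \<open>\<open>q\<close> is the last index on which \<open>g\<close> still has the value \<open>g p\<close>.\<close>
    define q where "q = Max {k \<in> {p..n}. g k = g p}"
    have q: "q \<in> {k \<in> {p..n}. g k = g p}" unfolding q_def using p by (intro Max_in) auto
    have qmax: "k \<le> q" if "k \<in> {p..n}" "g k = g p" for k unfolding q_def using that by (intro Max_ge) auto
    have const: "g k = g p" if "p \<le> k" "k \<le> q" for k using gm[of p k] gm[of k q] that q by auto
    have gq: "g q = g p" and pq: "p \<le> q" "q \<le> n" using q by auto
    have jump: "g q < g (Suc q)" if "q < n"
    proof -
      have "g (Suc q) \<noteq> g p" using qmax[of "Suc q"] pq that by auto
      then show ?thesis using gm[of q "Suc q"] gq that by linarith
    qed
    have "(\<Sum>k=p..q. v k + g k) = (\<Sum>k=p..q. g p + v k)"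
      by (rule sum.cong[OF refl]) (metis const atLeastAtMost_iff add.commute)
    then have split: "(\<Sum>k=p..n. v k + g k) = (\<Sum>k=p..q. g p + v k) + (\<Sum>k=Suc q..n. v k + g k)"
      using sum_split_at[of p q n "\<lambda>k. v k + g k"] pq by simp
    have IH: "(\<Sum>k=Suc q..n. v k + g k) = 0"
    proof (cases "q = n")
      case False
      then have "g (Suc q - 1) < g (Suc q)" using jump pq by simp
      then show ?thesis using less.hyps[of "Suc q"] p pq by auto
    qed simp
    have "?T p q \<le> g q"
      unfolding g_def using pq p jump[unfolded g_def] by (intro minmax_block_end) auto
    then have ge: "0 \<le> (\<Sum>k=p..q. g p + v k)"
      using neg_block_mean_le_iff(1)[of p q v "g p"] pq gq by simp
    have "(\<Sum>k=p..q. g p + v k) \<le> 0" if "1 < p \<longrightarrow> g (p - 1) < g p"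
    proof -
      have "g p \<le> ?T p q"
        unfolding g_def using pq p that[unfolded g_def]
        by (intro minmax_block_start cauchy_mean_neg_block_mean) auto
      then show ?thesis using neg_block_mean_le_iff(2)[of p q "g p" v] pq by simp
    qed
    then show ?thesis using ge split IH False by fastforce
  qed auto
qed

text \<open>Summation by parts, as an inequality: the boundary term bounds the sum from below when
  every increment of \<open>a\<close> is multiplied by a tail sum of the same sign.\<close>

lemma tail_sum_abel:
  fixes a d :: "nat \<Rightarrow> real"
  assumes "\<And>p. 1 \<le> p \<Longrightarrow> p < n \<Longrightarrow> 0 \<le> (a (Suc p) - a p) * (\<Sum>k=Suc p..n. d k)"
    and "1 \<le> p" "p \<le> n"
  shows "a p * (\<Sum>k=p..n. d k) \<le> (\<Sum>k=p..n. a k * d k)"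
  using assms(3,2)
proof (induction p rule: inc_induct)
  case base then show ?case by simp
next
  case (step p)
  have "a p * (\<Sum>k=p..n. d k) = a p * d p + a p * (\<Sum>k=Suc p..n. d k)"
    using step by (simp add: sum.atLeast_Suc_atMost algebra_simps)
  also have "\<dots> \<le> a p * d p + a (Suc p) * (\<Sum>k=Suc p..n. d k)"
    using assms(1)[of p] step by (simp add: algebra_simps)
  also have "\<dots> \<le> a p * d p + (\<Sum>k=Suc p..n. a k * d k)" using step by simp
  also have "\<dots> = (\<Sum>k=p..n. a k * d k)" using step by (simp add: sum.atLeast_Suc_atMost)
  finally show ?case .
qed

text \<open>The supergradient inequality reduces the claim to the nonnegativity of
  \<open>\<Sum>k. a k * (v k + g k)\<close> with \<open>a k = h (r k) - h (- g k)\<close>. Although \<open>a\<close> need not be monotone, it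
  increases along each block of constancy of \<open>g\<close>, and the tail sums vanish wherever \<open>g\<close> jumps.
  Hence summation by parts applies.\<close>

lemma minmax_mean_optimal:
  fixes v r :: "nat \<Rightarrow> real"
  assumes h: "antimono h" and r: "antimono_on {1..n} r"
  shows "total_score h n v (\<lambda>k. - minmax n (\<lambda>i j. - block_mean v i j) k) \<le> total_score h n v r"
proof (cases "n = 0")
  case False
  define g where "g = minmax n (\<lambda>i j. - block_mean v i j)"
  define a where "a k = h (r k) - h (- g k)" for k
  have gm: "g k \<le> g k'" if "k \<le> k'" "k' \<le> n" for k k' unfolding g_def using that by (rule minmax_mono)
  have tail: "0 \<le> (\<Sum>k=p..n. v k + g k)" if "1 \<le> p" "p \<le> n" for p
    using minmax_mean_tail_sums[of p n v] that by (auto simp: g_def)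
  have tail0: "(\<Sum>k=p..n. v k + g k) = 0" if "1 \<le> p" "p \<le> n" "1 < p \<Longrightarrow> g (p - 1) < g p" for p
    using minmax_mean_tail_sums[of p n v] that by (auto simp: g_def)
  have "a 1 * (\<Sum>k=1..n. v k + g k) \<le> (\<Sum>k=1..n. a k * (v k + g k))"
  proof (rule tail_sum_abel)
    fix p assume p: "1 \<le> p" "p < n"
    show "0 \<le> (a (Suc p) - a p) * (\<Sum>k=Suc p..n. v k + g k)"
    proof (cases "g p < g (Suc p)")
      case True then show ?thesis using tail0[of "Suc p"] p by simp
    next
      case False
      then have "g p = g (Suc p)" using gm[of p "Suc p"] p by simp
      moreover have "r (Suc p) \<le> r p" using r p by (auto simp: monotone_on_def)
      then have "h (r p) \<le> h (r (Suc p))" using h by (auto simp: monotone_def)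
      ultimately have "0 \<le> a (Suc p) - a p" by (simp add: a_def)
      then show ?thesis using tail[of "Suc p"] p by simp
    qed
  qed (use False in auto)
  then have "0 \<le> (\<Sum>k=1..n. a k * (v k + g k))" using tail0[of 1] False by simp
  also have "\<dots> \<le> (\<Sum>k=1..n. (antiderivative h (r k) + h (r k) * (v k - r k))
      - (antiderivative h (- g k) + h (- g k) * (v k - (- g k))))"
  proof (rule sum_mono)
    fix k
    show "a k * (v k + g k) \<le> (antiderivative h (r k) + h (r k) * (v k - r k))
      - (antiderivative h (- g k) + h (- g k) * (v k - (- g k)))"
      using antiderivative_supergradient[OF h, of "- g k" "r k"] by (simp add: a_def algebra_simps)
  qed
  finally show ?thesis by (simp add: total_score_def sum_subtractf flip: g_def)
qed (simp add: total_score_def)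

section \<open>Isotonic regression under a consistent loss\<close>

text \<open>At \<open>x = \<plusminus>\<infinity>\<close> the integral defining \<open>L x y\<close> has the value \<open>0\<close> if the integrand is not
  integrable. Integrability is therefore required explicitly wherever infinite arguments occur.\<close>

locale consistent_loss =
  fixes V :: "real \<Rightarrow> real \<Rightarrow> real" and M :: "real measure" and L :: "ereal \<Rightarrow> real \<Rightarrow> real"
  assumes V: "identification_function V"
    and integrable_real: "\<And>(x::real) y. integrable M (loss_integrand V (ereal x) y)"
    and L_eq: "\<And>x y. L x y = (\<integral>\<eta>. loss_integrand V x y \<eta> \<partial>M)"
begin

lemma weighted_loss_diff:
  fixes w y :: "nat \<Rightarrow> real" and a b :: "nat \<Rightarrow> ereal"
  assumes a: "\<And>k. k \<in> A \<Longrightarrow> integrable M (loss_integrand V (a k) (y k))"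
    and b: "\<And>k. k \<in> A \<Longrightarrow> integrable M (loss_integrand V (b k) (y k))"
  defines "D \<equiv> \<lambda>\<eta>. \<Sum>k\<in>A. (of_bool (ereal \<eta> \<le> a k) - of_bool (ereal \<eta> \<le> b k)) * (w k * V \<eta> (y k))"
  shows "integrable M D"
    and "(\<integral>\<eta>. D \<eta> \<partial>M) = (\<Sum>k\<in>A. w k * L (a k) (y k)) - (\<Sum>k\<in>A. w k * L (b k) (y k))"
proof -
  have D: "D = (\<lambda>\<eta>. \<Sum>k\<in>A. w k * (loss_integrand V (a k) (y k) \<eta> - loss_integrand V (b k) (y k) \<eta>))"
    unfolding D_def loss_integrand_def by (intro ext sum.cong) (auto simp: algebra_simps)
  have int: "integrable M (\<lambda>\<eta>. w k * (loss_integrand V (a k) (y k) \<eta> - loss_integrand V (b k) (y k) \<eta>))"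
    if "k \<in> A" for k
    using a[OF that] b[OF that] by (intro integrable_mult_right Bochner_Integration.integrable_diff) auto
  show "integrable M D" unfolding D using int by (rule Bochner_Integration.integrable_sum)
  have "(\<integral>\<eta>. D \<eta> \<partial>M)
      = (\<Sum>k\<in>A. \<integral>\<eta>. w k * (loss_integrand V (a k) (y k) \<eta> - loss_integrand V (b k) (y k) \<eta>) \<partial>M)"
    unfolding D using int by (rule Bochner_Integration.integral_sum)
  also have "\<dots> = (\<Sum>k\<in>A. w k * (L (a k) (y k) - L (b k) (y k)))"
    using a b by (intro sum.cong) (auto simp: L_eq Bochner_Integration.integral_diff)
  finally show "(\<integral>\<eta>. D \<eta> \<partial>M) = (\<Sum>k\<in>A. w k * L (a k) (y k)) - (\<Sum>k\<in>A. w k * L (b k) (y k))"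
    by (simp add: right_diff_distrib sum_subtractf)
qed

lemma minmax_T_lower_optimal:
  fixes w y f :: "nat \<Rightarrow> real" and n :: nat
  defines "g \<equiv> minmax n (\<lambda>i j. T_lower V (weighted_empirical w y i j))"
  assumes w: "\<And>k. 0 < w k" and f: "mono_on {1..n} f"
    and int: "\<And>k. k \<in> {1..n} \<Longrightarrow> integrable M (loss_integrand V (g k) (y k))"
  shows "(\<Sum>k=1..n. w k * L (g k) (y k)) \<le> (\<Sum>k=1..n. w k * L (ereal (f k)) (y k))"
proof -
  define D where "D \<eta> = (\<Sum>k=1..n. (of_bool (ereal \<eta> \<le> g k) - of_bool (ereal \<eta> \<le> ereal (f k)))
    * (w k * V \<eta> (y k)))" for \<eta>
  have nonneg: "0 \<le> - D \<eta>" for \<eta>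
  proof -
    have "(\<Sum>k=1..n. of_bool (ereal \<eta> \<le> g k) * (w k * V \<eta> (y k)))
        \<le> (\<Sum>k=1..n. of_bool (\<eta> \<le> f k) * (w k * V \<eta> (y k)))"
      unfolding g_def
      using T_lower_ge_imp_nonpos[OF V w, where y = y and x = \<eta>]
        T_lower_lt_imp_nonneg[OF w, where V = V and y = y and x = \<eta>]
      by (intro minmax_pointwise_optimal cauchy_mean_T_lower V w f) (auto simp: block_sum_def)
    then show ?thesis by (simp add: D_def left_diff_distrib sum_subtractf)
  qed
  have "0 \<le> (\<integral>\<eta>. - D \<eta> \<partial>M)" using nonneg by (intro integral_nonneg_AE always_eventually allI)
  then have "(\<integral>\<eta>. D \<eta> \<partial>M) \<le> 0" unfolding integral_minus by linarith
  then show ?thesis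
    using weighted_loss_diff(2)[of "{1..n}" g y "\<lambda>k. ereal (f k)" w] int integrable_real
    by (simp add: D_def[abs_def])
qed

text \<open>If every block sum starting at \<open>m\<close> is strictly negative, raising an increasing function to
  \<open>max (f k) c\<close> for \<open>k \<ge> m\<close> lowers the loss density at each \<open>\<eta> \<in> {f m<..c}\<close>
  strictly and raises it nowhere. For an optimal \<open>f\<close> such \<open>\<eta>\<close> must form a null set.\<close>

lemma AE_le_of_optimal:
  fixes w y f :: "nat \<Rightarrow> real" and n m :: nat
  assumes m: "1 \<le> m" "m \<le> n" and f: "mono_on {1..n} f"
    and neg: "\<And>j x. m \<le> j \<Longrightarrow> j \<le> n \<Longrightarrow> block_sum V w y m j x < 0"
    and opt: "\<And>f'. mono_on {1..n} f' \<Longrightarrow>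
      (\<Sum>k=1..n. w k * L (ereal (f k)) (y k)) \<le> (\<Sum>k=1..n. w k * L (ereal (f' k)) (y k))"
  shows "AE \<eta> in M. \<eta> \<le> f m"
proof -
  have AE_c: "AE \<eta> in M. \<not> (f m < \<eta> \<and> \<eta> \<le> c)" for c
  proof -
    define f' where "f' k = (if m \<le> k then max (f k) c else f k)" for k
    have "mono_on {1..n} f'"
    proof (rule mono_onI)
      fix i j assume "i \<in> {1..n}" "j \<in> {1..n}" "i \<le> j"
      then have "f i \<le> f j" using monotone_onD[OF f] by blast
      then show "f' i \<le> f' j" using \<open>i \<le> j\<close> by (auto simp: f'_def)
    qed
    note opt = opt[OF this]
    define D where "D \<eta> = (\<Sum>k=1..n. (of_bool (ereal \<eta> \<le> ereal (f' k)) - of_bool (ereal \<eta> \<le> ereal (f k)))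
      * (w k * V \<eta> (y k)))" for \<eta>
    have sign: "D \<eta> \<le> 0 \<and> (f m < \<eta> \<and> \<eta> \<le> c \<longrightarrow> D \<eta> < 0)" for \<eta>
    proof (cases "\<eta> \<le> c")
      case True
      obtain u where u: "1 \<le> u" "u \<le> Suc n" "\<And>k. k \<in> {1..n} \<Longrightarrow> \<eta> \<le> f k \<longleftrightarrow> u \<le> k"
        using upper_set_of_mono[OF f] by blast
      have "D \<eta> = (\<Sum>k=1..n. if m \<le> k \<and> k < u then w k * V \<eta> (y k) else 0)"
        unfolding D_def
      proof (rule sum.cong[OF refl])
        fix k assume k: "k \<in> {1..n}"
        have "\<eta> \<le> f' k \<longleftrightarrow> m \<le> k \<or> u \<le> k" using u(3)[OF k] True by (auto simp: f'_def)
        then show "(of_bool (ereal \<eta> \<le> ereal (f' k)) - of_bool (ereal \<eta> \<le> ereal (f k))) * (w k * V \<eta> (y k))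
          = (if m \<le> k \<and> k < u then w k * V \<eta> (y k) else 0)"
          using u(3)[OF k] by auto
      qed
      also have "\<dots> = (\<Sum>k\<in>{1..n} \<inter> {k. m \<le> k \<and> k < u}. w k * V \<eta> (y k))"
        by (simp add: sum.inter_restrict)
      also have "{1..n} \<inter> {k. m \<le> k \<and> k < u} = {m..u - 1}" using m u by auto
      finally have D: "D \<eta> = block_sum V w y m (u - 1) \<eta>" by (simp add: block_sum_def)
      show ?thesis
      proof (cases "m < u")
        case True
        then have "block_sum V w y m (u - 1) \<eta> < 0" using u by (intro neg) auto
        then show ?thesis using D by simp
      next
        case False
        then have "\<eta> \<le> f m" using u(3)[of m] m by auto
        moreover have "block_sum V w y m (u - 1) \<eta> = 0" using False u m by (simp add: block_sum_def)
        ultimately show ?thesis using D by simp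
      qed
    next
      case False
      have "\<eta> \<le> f' k \<longleftrightarrow> \<eta> \<le> f k" for k using False by (auto simp: f'_def)
      then have "D \<eta> = 0" by (simp add: D_def)
      then show ?thesis using False by simp
    qed
    have int: "integrable M D" and eq: "(\<integral>\<eta>. D \<eta> \<partial>M)
        = (\<Sum>k=1..n. w k * L (ereal (f' k)) (y k)) - (\<Sum>k=1..n. w k * L (ereal (f k)) (y k))"
      using weighted_loss_diff[of "{1..n}" "\<lambda>k. ereal (f' k)" y "\<lambda>k. ereal (f k)" w] integrable_real
      by (auto simp: D_def[abs_def])
    have "(\<integral>\<eta>. - D \<eta> \<partial>M) = - (\<integral>\<eta>. D \<eta> \<partial>M)" by (rule integral_minus)
    then have "(\<integral>\<eta>. - D \<eta> \<partial>M) \<le> 0" using eq opt by linarith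
    moreover have "0 \<le> (\<integral>\<eta>. - D \<eta> \<partial>M)" using sign by (intro integral_nonneg_AE always_eventually allI) simp
    ultimately have "(\<integral>\<eta>. - D \<eta> \<partial>M) = 0" by linarith
    moreover have "integrable M (\<lambda>\<eta>. - D \<eta>)" using int by (rule Bochner_Integration.integrable_minus)
    moreover have "AE \<eta> in M. 0 \<le> - D \<eta>" using sign by (intro always_eventually allI) simp
    ultimately have "AE \<eta> in M. - D \<eta> = 0"
      using integral_nonneg_eq_0_iff_AE by blast
    then show ?thesis
    proof (rule AE_mp, intro always_eventually allI impI)
      fix \<eta> assume "- D \<eta> = 0"
      then show "\<not> (f m < \<eta> \<and> \<eta> \<le> c)" using sign[of \<eta>] by linarith
    qed
  qed
  have "AE \<eta> in M. \<forall>N::nat. \<not> (f m < \<eta> \<and> \<eta> \<le> real N)"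
    unfolding AE_all_countable using AE_c by blast
  then show ?thesis
  proof (rule AE_mp, intro always_eventually allI impI)
    fix \<eta> assume *: "\<forall>N::nat. \<not> (f m < \<eta> \<and> \<eta> \<le> real N)"
    obtain N :: nat where "\<eta> \<le> real N" using real_arch_simple by blast
    then show "\<eta> \<le> f m" using * not_less by blast
  qed
qed

text \<open>By monotonicity, \<open>V \<eta> y\<close> has a constant sign \<open>s\<close> for all \<open>\<eta>\<close> far enough to the left. Bounded losses as
  \<open>c\<close> tends to \<open>-\<infinity>\<close> therefore bound a monotone sequence of integrals, and monotone
  convergence applies.\<close>

lemma integrable_MInf:
  assumes bound: "\<And>c. c \<le> c0 \<Longrightarrow> \<bar>L (ereal c) y\<bar> \<le> B"
  shows "integrable M (loss_integrand V (-\<infinity>) y)"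
proof -
  have mono: "V x y \<le> V x' y" if "x \<le> x'" for x x'
    using V that by (auto simp: identification_function_def mono_def)
  \<comment> \<open>\<open>s = \<plusminus>1\<close> is the sign of \<open>V\<close> to the left of \<open>b\<close>.\<close>
  obtain b s where b: "b \<le> c0" and s: "s * s = (1::real)" and sgn: "\<And>\<eta>. \<eta> \<le> b \<Longrightarrow> 0 \<le> s * V \<eta> y"
  proof (cases "\<exists>b. V b y < 0")
    case True
    then obtain b where "V b y < 0" by blast
    then show ?thesis using that[of "min b c0" "-1"] mono[of _ b] by fastforce
  next
    case False
    then show ?thesis using that[of c0 1] by (auto simp: not_less)
  qed
  define F where "F N \<eta> = s * (loss_integrand V (ereal b) y \<eta> - loss_integrand V (ereal (b - real N)) y \<eta>)"
    for N :: nat and \<eta>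
  define F' where "F' \<eta> = s * (loss_integrand V (ereal b) y \<eta> - loss_integrand V (-\<infinity>) y \<eta>)" for \<eta>
  have F: "F N \<eta> = (if b - real N < \<eta> \<and> \<eta> \<le> b then s * V \<eta> y else 0)" for N \<eta>
    unfolding F_def loss_integrand_def by (auto simp: algebra_simps)
  have F': "F' \<eta> = (if \<eta> \<le> b then s * V \<eta> y else 0)" for \<eta>
    unfolding F'_def loss_integrand_def by (auto simp: algebra_simps)
  have int_F: "integrable M (F N)" for N
    unfolding F_def using integrable_real by auto
  have integral_F: "(\<integral>\<eta>. F N \<eta> \<partial>M) = s * (L (ereal b) y - L (ereal (b - real N)) y)" for N
    unfolding F_def using integrable_real by (simp add: L_eq)
  have mono_F: "F N \<eta> \<le> F N' \<eta>" if "N \<le> N'" for N N' \<eta>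
    using that sgn[of \<eta>] by (auto simp: F)
  have "incseq (\<lambda>N. \<integral>\<eta>. F N \<eta> \<partial>M)"
    using mono_F int_F by (auto intro!: integral_mono simp: incseq_def)
  moreover have "(\<integral>\<eta>. F N \<eta> \<partial>M) \<le> 2 * B" for N
  proof -
    have "\<bar>s\<bar> = 1" using s by (metis abs_mult abs_1 abs_mult_self_eq abs_eq_iff' mult_cancel_left2 square_eq_1_iff)
    then have "(\<integral>\<eta>. F N \<eta> \<partial>M) \<le> \<bar>L (ereal b) y - L (ereal (b - real N)) y\<bar>"
      unfolding integral_F by (metis abs_ge_self abs_mult mult_1)
    then show ?thesis using bound[of b] bound[of "b - real N"] b by linarith
  qed
  ultimately obtain I where I: "(\<lambda>N. \<integral>\<eta>. F N \<eta> \<partial>M) \<longlonglongrightarrow> I"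
    using incseq_convergent by metis
  have lim: "(\<lambda>N. F N \<eta>) \<longlonglongrightarrow> F' \<eta>" for \<eta>
  proof (rule tendsto_eventually)
    obtain N0 :: nat where N0: "b - \<eta> < real N0" using reals_Archimedean2 by blast
    show "eventually (\<lambda>N. F N \<eta> = F' \<eta>) sequentially"
      using eventually_ge_at_top[of N0] by eventually_elim (use N0 in \<open>auto simp: F F'\<close>)
  qed
  have int_F': "integrable M F'"
  proof (rule integrable_monotone_convergence[OF int_F _ _ I])
    show "AE \<eta> in M. mono (\<lambda>N. F N \<eta>)" using mono_F by (auto simp: mono_def)
    show "AE \<eta> in M. (\<lambda>N. F N \<eta>) \<longlonglongrightarrow> F' \<eta>" using lim by auto
    show "F' \<in> borel_measurable M"
      by (rule borel_measurable_LIMSEQ_real[OF lim borel_measurable_integrable[OF int_F]])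
  qed
  have "loss_integrand V (-\<infinity>) y = (\<lambda>\<eta>. loss_integrand V (ereal b) y \<eta> - s * F' \<eta>)"
    unfolding F'_def mult.assoc[symmetric] s by simp
  then show ?thesis using int_F' integrable_real by simp
qed

end

section \<open>Integrability of the losses at infinite values\<close>

text \<open>Induction on \<open>k\<close>. The bounds for \<open>p = 0\<close> and \<open>p = k\<close> combine to a lower bound on
  \<open>\<Sum>j\<le>k. w j * l c j\<close> and to an upper bound on \<open>\<Sum>j\<le>k. (w j - e) * l c j\<close>. Once the
  earlier \<open>l c j\<close> are bounded, these bound \<open>l c k\<close> from below and from above, as both
  coefficients are positive.\<close>

lemma bounded_of_weighted_prefix_bounds:
  fixes l :: "real \<Rightarrow> nat \<Rightarrow> real" and w C D :: "nat \<Rightarrow> real"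
  assumes w: "\<And>k. k \<in> {1..m} \<Longrightarrow> e < w k" "0 < e"
    and suffix: "\<And>c p. c \<in> X \<Longrightarrow> p \<le> m \<Longrightarrow> (\<Sum>k=Suc p..m. w k * l c k) \<le> D p"
    and mixed: "\<And>c p. c \<in> X \<Longrightarrow> p \<le> m \<Longrightarrow> C p \<le> e * (\<Sum>k=1..p. l c k) + (\<Sum>k=Suc p..m. w k * l c k)"
    and "k \<in> {1..m}"
  shows "\<exists>B. \<forall>c\<in>X. \<bar>l c k\<bar> \<le> B"
  using assms(5)
proof (induction k rule: less_induct)
  case (less k)
  then have "\<forall>j\<in>{1..k-1}. \<exists>B. \<forall>c\<in>X. \<bar>l c j\<bar> \<le> B" by auto
  then obtain B where B: "\<And>j c. j \<in> {1..k-1} \<Longrightarrow> c \<in> X \<Longrightarrow> \<bar>l c j\<bar> \<le> B j" by metis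
  have k: "1 \<le> k" "k \<le> m" using less.prems by auto
  have last: "(\<Sum>j=1..k. f j) = (\<Sum>j=1..k-1. f j) + f k" for f :: "nat \<Rightarrow> real"
    using k by (cases k) auto
  have rest: "\<bar>\<Sum>j=1..k-1. u j * l c j\<bar> \<le> (\<Sum>j=1..k-1. \<bar>u j\<bar> * B j)" if "c \<in> X" for u :: "nat \<Rightarrow> real" and c
    using B that by (intro order_trans[OF sum_abs] sum_mono) (auto simp: abs_mult intro!: mult_left_mono)
  let ?R = "\<lambda>u. \<Sum>j=1..k-1. \<bar>u j\<bar> * B j :: real"
  have "\<bar>l c k\<bar> \<le> \<bar>(C 0 - D k - ?R w) / w k\<bar> + \<bar>(D 0 - C k + ?R (\<lambda>j. w j - e)) / (w k - e)\<bar>"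
    if c: "c \<in> X" for c
  proof -
    have wk: "e < w k" using w k by auto
    have tot: "(\<Sum>j=1..m. w j * l c j) = (\<Sum>j=1..k. w j * l c j) + (\<Sum>j=Suc k..m. w j * l c j)"
      using k by (intro sum_split_at) auto
    have "C 0 \<le> (\<Sum>j=1..m. w j * l c j)" using mixed[OF c, of 0] by simp
    then have "C 0 - D k - ?R w \<le> w k * l c k"
      using tot last[of "\<lambda>j. w j * l c j"] suffix[OF c k(2)] rest[OF c, of w] by linarith
    then have lower: "(C 0 - D k - ?R w) / w k \<le> l c k"
      using wk w(2) by (simp add: divide_le_eq mult.commute)
    have "(\<Sum>j=1..k. (w j - e) * l c j) = (\<Sum>j=1..k. w j * l c j) - e * (\<Sum>j=1..k. l c j)"
      by (simp add: left_diff_distrib sum_subtractf sum_distrib_left)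
    then have "(w k - e) * l c k \<le> D 0 - C k + ?R (\<lambda>j. w j - e)"
      using last[of "\<lambda>j. (w j - e) * l c j"] tot suffix[OF c, of 0] mixed[OF c k(2)]
        rest[OF c, of "\<lambda>j. w j - e"] by simp
    then have upper: "l c k \<le> (D 0 - C k + ?R (\<lambda>j. w j - e)) / (w k - e)"
      using wk by (simp add: le_divide_eq mult.commute)
    show ?thesis using lower upper by linarith
  qed
  then show ?case by blast
qed

context consistent_loss
begin

text \<open>Divergence is excluded for different reasons at the two infinite values. On the
  block where \<open>g = \<infinity>\<close> it suffices to vary \<open>fh\<close>. On the block where \<open>g = -\<infinity>\<close> the
  competitors set \<open>fh\<close> to a small constant \<open>c\<close> up to \<open>m\<close> and raise \<open>rh\<close> to \<open>R\<close> up to \<open>p\<close>; the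
  estimates that follow are uniform in \<open>c\<close>, which bounds each loss on the block.\<close>

lemma integrable_at_minmax:
  fixes y fh rh :: "nat \<Rightarrow> real" and h :: "real \<Rightarrow> real" and n :: nat
  defines "w \<equiv> \<lambda>k. h (rh k)"
  defines "g \<equiv> minmax n (\<lambda>i j. T_lower V (weighted_empirical w y i j))"
  assumes h_pos: "\<And>x. 0 < h x" and h: "antimono h" and h_lim: "(h \<longlongrightarrow> 0) at_top"
    and fh: "mono_on {1..n} fh" and rh: "antimono_on {1..n} rh"
    and opt: "\<And>f r. mono_on {1..n} f \<Longrightarrow> antimono_on {1..n} r \<Longrightarrow>
      total_score h n (\<lambda>k. L (ereal (fh k)) (y k)) rh \<le> total_score h n (\<lambda>k. L (ereal (f k)) (y k)) r"
    and k: "k \<in> {1..n}"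
  shows "integrable M (loss_integrand V (g k) (y k))"
proof (cases "g k")
  case (real x)
  then show ?thesis using integrable_real by simp
next
  case PInf
  have w: "0 < w k" for k using h_pos by (simp add: w_def)
  have "mono_on {1..n} g" unfolding g_def by (auto intro!: mono_onI minmax_mono)
  \<comment> \<open>\<open>m\<close> is the start of the block on which \<open>g = \<infinity>\<close>.\<close>
  then obtain m where m: "1 \<le> m" "m \<le> Suc n" "\<And>k. k \<in> {1..n} \<Longrightarrow> \<infinity> \<le> g k \<longleftrightarrow> m \<le> k"
    using upper_set_of_mono[of n g \<infinity>] by blast
  have mk: "m \<le> k" using m(3)[OF k] PInf by simp
  then have mn: "m \<le> n" using k by simp
  have gm: "g m = \<infinity>" using m(3)[of m] m(1) mn by simp
  have neg: "block_sum V w y m j x < 0" if j: "m \<le> j" "j \<le> n" for j x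
  proof (rule T_lower_gt_imp_neg[OF V w j(1)])
    have "g m \<le> T_lower V (weighted_empirical w y m j)"
      unfolding g_def
    proof (rule minmax_block_start[OF cauchy_mean_T_lower[OF V w] m(1) j])
      assume "1 < m"
      then have "g (m - 1) \<noteq> \<infinity>" using m(3)[of "m - 1"] mn by force
      then show "minmax n (\<lambda>i j. T_lower V (weighted_empirical w y i j)) (m - 1)
          < minmax n (\<lambda>i j. T_lower V (weighted_empirical w y i j)) m"
        using gm by (simp add: g_def less_top[symmetric] top_ereal_def)
    qed
    then show "ereal x < T_lower V (weighted_empirical w y m j)" using gm by simp
  qed
  have opt_w: "(\<Sum>k=1..n. w k * L (ereal (fh k)) (y k)) \<le> (\<Sum>k=1..n. w k * L (ereal (f k)) (y k))"
    if "mono_on {1..n} f" for f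
    using opt[OF that rh]
    by (simp add: total_score_def w_def right_diff_distrib sum.distrib sum_subtractf)
  have AE: "AE \<eta> in M. \<eta> \<le> fh m"
    by (rule AE_le_of_optimal[OF m(1) mn fh neg opt_w])
  have "fh m \<le> fh k" using monotone_onD[OF fh, of m k] m(1) mn mk k by auto
  then have "AE \<eta> in M. loss_integrand V (ereal (fh k)) (y k) \<eta> = loss_integrand V \<infinity> (y k) \<eta>"
    by (intro eventually_mono[OF AE]) (auto simp: loss_integrand_def)
  moreover have "loss_integrand V \<infinity> (y k) \<in> borel_measurable M"
  proof (rule borel_measurable_LIMSEQ_real)
    show "(\<lambda>N. loss_integrand V (ereal (real N)) (y k) \<eta>) \<longlonglongrightarrow> loss_integrand V \<infinity> (y k) \<eta>" for \<eta>
    proof (rule tendsto_eventually)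
      obtain N0 :: nat where N0: "\<eta> \<le> real N0" using real_arch_simple by blast
      show "eventually (\<lambda>N. loss_integrand V (ereal (real N)) (y k) \<eta> = loss_integrand V \<infinity> (y k) \<eta>) sequentially"
        using eventually_ge_at_top[of N0] by eventually_elim (use N0 in \<open>auto simp: loss_integrand_def\<close>)
    qed
  qed (use integrable_real in auto)
  ultimately show ?thesis
    unfolding PInf using integrable_real integrable_cong_AE_imp by blast
next
  case MInf
  have w: "0 < w k" for k using h_pos by (simp add: w_def)
  have gmono: "g i \<le> g j" if "i \<le> j" "j \<le> n" for i j unfolding g_def using that by (rule minmax_mono)
  \<comment> \<open>The end of the block on which \<open>g = -\<infinity>\<close>.\<close>
  define m where "m = Max {k \<in> {1..n}. g k = -\<infinity>}"
  have "m \<in> {k \<in> {1..n}. g k = -\<infinity>}" unfolding m_def using k MInf by (intro Max_in) auto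
  then have m: "1 \<le> m" "m \<le> n" "g m = -\<infinity>" by auto
  have mmax: "j \<le> m" if "j \<in> {1..n}" "g j = -\<infinity>" for j unfolding m_def using that by (intro Max_ge) auto
  have km: "k \<in> {1..m}" using mmax[OF k MInf] k by simp
  have suffix_nonneg: "0 \<le> block_sum V w y i m x" if i: "1 \<le> i" "i \<le> m" for i x
  proof (rule T_lower_lt_imp_nonneg[OF w i(2)])
    have "T_lower V (weighted_empirical w y i m) \<le> g m"
      unfolding g_def
    proof (rule minmax_block_end[OF i m(2)])
      assume "m < n"
      then have "g (Suc m) \<noteq> -\<infinity>" using mmax[of "Suc m"] by auto
      then show "minmax n (\<lambda>i j. T_lower V (weighted_empirical w y i j)) m
          < minmax n (\<lambda>i j. T_lower V (weighted_empirical w y i j)) (Suc m)"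
        using m by (simp add: g_def)
    qed
    then show "T_lower V (weighted_empirical w y i m) < ereal x" using m by simp
  qed
  \<comment> \<open>Below \<open>fh 1\<close>, setting the first \<open>m\<close> values of \<open>fh\<close> to a constant keeps it increasing.\<close>
  define c0 where "c0 = fh 1"
  have c0: "c0 \<le> fh j" if "j \<in> {1..n}" for j
    unfolding c0_def using monotone_onD[OF fh, of 1 j] that by auto
  have w1: "w 1 \<le> w j" if "j \<in> {1..n}" for j
    unfolding w_def using monotone_onD[OF rh, of 1 j] that by (intro antimonoD[OF h]) auto
  have "eventually (\<lambda>x. h x < w 1) at_top"
    using order_tendstoD(2)[OF h_lim w] .
  then have "eventually (\<lambda>x. h x < w 1 \<and> rh 1 \<le> x) at_top"
    using eventually_ge_at_top by (rule eventually_conj)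
  then obtain R where R: "h R < w 1" "rh 1 \<le> R"
    using eventually_happens[of _ at_top] by fastforce
  define l where "l c j = L (ereal c) (y j)" for c j
  \<comment> \<open>Lowering \<open>c\<close> cannot increase the weighted loss of a final part of the block, because the
    corresponding block sums of \<open>V\<close> are nonnegative.\<close>
  have suffix: "(\<Sum>j=Suc p..m. w j * l c j) \<le> (\<Sum>j=Suc p..m. w j * l c0 j)" if c: "c \<le> c0" "p \<le> m" for c p
  proof -
    define D where "D \<eta> = (\<Sum>j=Suc p..m. (of_bool (ereal \<eta> \<le> ereal c0) - of_bool (ereal \<eta> \<le> ereal c))
      * (w j * V \<eta> (y j)))" for \<eta>
    have "0 \<le> D \<eta>" for \<eta>
    proof -
      have "D \<eta> = (of_bool (\<eta> \<le> c0) - of_bool (\<eta> \<le> c)) * block_sum V w y (Suc p) m \<eta>"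
        by (simp add: D_def block_sum_def sum_distrib_left)
      moreover have "0 \<le> block_sum V w y (Suc p) m \<eta>"
        using suffix_nonneg[of "Suc p" \<eta>] c by (cases "p = m") (auto simp: block_sum_def)
      ultimately show ?thesis using c by (auto simp: of_bool_def)
    qed
    then have "0 \<le> (\<integral>\<eta>. D \<eta> \<partial>M)" by (intro integral_nonneg_AE always_eventually allI)
    then show ?thesis
      using weighted_loss_diff(2)[of "{Suc p..m}" "\<lambda>_. ereal c0" y "\<lambda>_. ereal c" w] integrable_real
      by (simp add: D_def[abs_def] l_def)
  qed
  define r where "r p j = (if j \<le> p then R else rh j)" for p j
  \<comment> \<open>The part of the inequality \<open>opt\<close> that does not depend on \<open>c\<close>.\<close>
  define C where "C p = total_score h n (\<lambda>j. L (ereal (fh j)) (y j)) rh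
    - (\<Sum>j=1..n. antiderivative h (r p j) - h (r p j) * r p j)
    - (\<Sum>j=Suc m..n. w j * L (ereal (fh j)) (y j))" for p
  have mixed: "C p \<le> h R * (\<Sum>j=1..p. l c j) + (\<Sum>j=Suc p..m. w j * l c j)"
    if c: "c \<in> {..c0}" and p: "p \<le> m" for c p
  proof -
    \<comment> \<open>Minimality against this competitor for the first and \<open>r p\<close> for the second coordinate.\<close>
    define f where "f j = (if j \<le> m then c else fh j)" for j
    have f: "mono_on {1..n} f"
    proof (rule mono_onI)
      fix i j assume ij: "i \<in> {1..n}" "j \<in> {1..n}" "i \<le> j"
      then have "fh i \<le> fh j" using monotone_onD[OF fh] by blast
      then show "f i \<le> f j" using c0[of j] ij c by (auto simp: f_def)
    qed
    have r: "antimono_on {1..n} (r p)"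
    proof (rule monotone_onI)
      fix i j assume ij: "i \<in> {1..n}" "j \<in> {1..n}" "i \<le> j"
      then have "rh j \<le> rh i" "rh j \<le> rh 1"
        using monotone_onD[OF rh, of i j] monotone_onD[OF rh, of 1 j] by auto
      then show "r p j \<le> r p i" using R ij by (auto simp: r_def)
    qed
    have "(\<Sum>j=1..n. h (r p j) * L (ereal (f j)) (y j))
        = (\<Sum>j=1..p. h (r p j) * L (ereal (f j)) (y j))
          + (\<Sum>j=Suc p..m. h (r p j) * L (ereal (f j)) (y j))
          + (\<Sum>j=Suc m..n. h (r p j) * L (ereal (f j)) (y j))"
      using sum_split_at[of 1 m n "\<lambda>j. h (r p j) * L (ereal (f j)) (y j)"]
        sum_split_at[of 1 p m "\<lambda>j. h (r p j) * L (ereal (f j)) (y j)"] m p by simp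
    also have "(\<Sum>j=1..p. h (r p j) * L (ereal (f j)) (y j)) = h R * (\<Sum>j=1..p. l c j)"
      unfolding sum_distrib_left using p by (intro sum.cong) (auto simp: r_def f_def l_def)
    also have "(\<Sum>j=Suc p..m. h (r p j) * L (ereal (f j)) (y j)) = (\<Sum>j=Suc p..m. w j * l c j)"
      by (intro sum.cong) (auto simp: r_def f_def l_def w_def)
    also have "(\<Sum>j=Suc m..n. h (r p j) * L (ereal (f j)) (y j))
        = (\<Sum>j=Suc m..n. w j * L (ereal (fh j)) (y j))"
      using p by (intro sum.cong) (auto simp: r_def f_def w_def)
    finally have split: "(\<Sum>j=1..n. h (r p j) * L (ereal (f j)) (y j))
        = h R * (\<Sum>j=1..p. l c j) + (\<Sum>j=Suc p..m. w j * l c j)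
          + (\<Sum>j=Suc m..n. w j * L (ereal (fh j)) (y j))" .
    have "total_score h n (\<lambda>j. L (ereal (f j)) (y j)) (r p)
        = (\<Sum>j=1..n. antiderivative h (r p j) - h (r p j) * r p j)
          + (\<Sum>j=1..n. h (r p j) * L (ereal (f j)) (y j))"
      by (simp add: total_score_def right_diff_distrib sum.distrib[symmetric] algebra_simps)
    then show ?thesis using opt[OF f r] split unfolding C_def by linarith
  qed
  have "\<exists>B. \<forall>c\<in>{..c0}. \<bar>l c k\<bar> \<le> B"
  proof (rule bounded_of_weighted_prefix_bounds[OF _ h_pos _ mixed km])
    show "h R < w j" if "j \<in> {1..m}" for j using R w1[of j] that m by auto
    show "(\<Sum>j=Suc p..m. w j * l c j) \<le> (\<Sum>j=Suc p..m. w j * l c0 j)" if "c \<in> {..c0}" "p \<le> m" for c p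
      using suffix that by simp
  qed
  then obtain B where "\<And>c. c \<le> c0 \<Longrightarrow> \<bar>L (ereal c) (y k)\<bar> \<le> B" by (auto simp: l_def)
  then show ?thesis unfolding MInf by (rule integrable_MInf)
qed

end

section \<open>Transfer to the covariates\<close>

lemma covariates_ge:
  fixes z :: "nat \<Rightarrow> 'z::linorder"
  assumes "strict_mono_on {1..n} z" "l \<in> {1..n}"
  shows "{j \<in> {1..n}. z l \<le> z j} = {l..n}"
  using assms by (auto simp: strict_mono_on_less_eq)

lemma g1_lower_covariate:
  assumes "strict_mono_on {1..n} z" "l \<in> {1..n}"
  shows "g1_lower V n z y w (z l) = minmax n (\<lambda>i j. T_lower V (weighted_empirical w y i j)) l"
  unfolding g1_lower_def minmax_def covariates_ge[OF assms] ..

lemma expectation_empirical: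
  assumes "i \<le> j"
  shows "measure_pmf.expectation (empirical v i j) (\<lambda>v. v) = block_mean v i j"
  using assms by (simp add: empirical_def block_mean_def integral_pmf_of_set)

lemma g2_lower_covariate:
  assumes "strict_mono_on {1..n} z" "l \<in> {1..n}"
  shows "g2_lower L n z y g1 (z l)
    = - minmax n (\<lambda>i j. - block_mean (\<lambda>k. L (g1 (z k)) (y k)) i j) l"
proof -
  have "(MAX i\<in>{1..j}. - measure_pmf.expectation (empirical (\<lambda>k. L (g1 (z k)) (y k)) i j) (\<lambda>v. v))
      = (MAX i\<in>{1..j}. - block_mean (\<lambda>k. L (g1 (z k)) (y k)) i j)" for j
    by (intro arg_cong[of _ _ Max] image_cong) (auto simp: expectation_empirical)
  then show ?thesis unfolding g2_lower_def minmax_def covariates_ge[OF assms] by simp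
qed

lemma objective_eq_total_score:
  assumes "\<And>k. k \<in> {1..n} \<Longrightarrow> g1 (z k) = f k" "\<And>k. k \<in> {1..n} \<Longrightarrow> g2 (z k) = r k"
  shows "objective h L n z y g1 g2 = total_score h n (\<lambda>k. L (f k) (y k)) r"
  unfolding objective_def total_score_def using assms by (intro sum.cong) auto

lemma monotone_on_covariates_iff:
  fixes z :: "nat \<Rightarrow> 'z::linorder"
  assumes "strict_mono_on {1..n} z"
  shows "monotone_on (z ` {1..n}) (\<le>) ord f \<longleftrightarrow> monotone_on {1..n} (\<le>) ord (\<lambda>k. f (z k))"
  using strict_mono_on_less_eq[OF assms] by (auto simp: monotone_on_def)

text \<open>Monotone sequences on \<open>{1..n}\<close> are exactly the monotone functions on the covariates, so a
  minimiser beats every competitor given by indices.\<close>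

lemma minimizer_optimal_on_indices:
  fixes z :: "nat \<Rightarrow> 'z::linorder" and g1_hat g2_hat :: "'z \<Rightarrow> real"
  assumes z: "strict_mono_on {1..n} z"
    and min: "is_minimizer h L n z y (\<lambda>x. ereal (g1_hat x)) g2_hat"
    and f: "mono_on {1..n} f" and r: "antimono_on {1..n} r"
  shows "total_score h n (\<lambda>k. L (ereal (g1_hat (z k))) (y k)) (\<lambda>k. g2_hat (z k))
    \<le> total_score h n (\<lambda>k. L (ereal (f k)) (y k)) r"
proof -
  have inj: "inj_on z {1..n}" using z by (rule strict_mono_on_imp_inj_on)
  define F where "F = f \<circ> the_inv_into {1..n} z"
  define G where "G = r \<circ> the_inv_into {1..n} z"
  have F: "F (z k) = f k" and G: "G (z k) = r k" if "k \<in> {1..n}" for k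
    using the_inv_into_f_f[OF inj that] by (simp_all add: F_def G_def)
  have "mono_on (z ` {1..n}) F" "antimono_on (z ` {1..n}) G"
    unfolding monotone_on_covariates_iff[OF z] using f r F G by (auto simp: monotone_on_def)
  then have "objective h L n z y (\<lambda>x. ereal (g1_hat x)) g2_hat \<le> objective h L n z y (\<lambda>x. ereal (F x)) G"
    using min unfolding is_minimizer_def by blast
  also have "\<dots> = total_score h n (\<lambda>k. L (ereal (f k)) (y k)) r"
    using F G by (intro objective_eq_total_score) auto
  finally show ?thesis
    using objective_eq_total_score[of n "\<lambda>x. ereal (g1_hat x)" z "\<lambda>k. ereal (g1_hat (z k))" g2_hat
        "\<lambda>k. g2_hat (z k)" h L y] by simp
qed

theorem proposition3p8:
  fixes V :: "real \<Rightarrow> real \<Rightarrow> real"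
    and L :: "ereal \<Rightarrow> real \<Rightarrow> real"
    and h :: "real \<Rightarrow> real"
    and n :: nat
    and z :: "nat \<Rightarrow> 'z::linorder"
    and y :: "nat \<Rightarrow> real"
    and g1_hat g2_hat :: "'z \<Rightarrow> real"
  assumes "identification_function V"
    and "L \<in> consistent_losses V"
    and "strict_mono_on {1..n} z"
    and "\<And>x. h x > 0"
    and "antimono h"
    and "(h \<longlongrightarrow> 0) at_top"
    and "is_minimizer h L n z y (\<lambda>x. ereal (g1_hat x)) g2_hat"
  shows "is_minimizer h L n z y
           (g1_lower V n z y (\<lambda>i. h (g2_hat (z i))))
           (g2_lower L n z y (g1_lower V n z y (\<lambda>i. h (g2_hat (z i)))))"
proof -
  note z = assms(3) and h_pos = assms(4) and h = assms(5)
  obtain M :: "real measure" where M: "consistent_loss V M L"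
    using assms(1,2) unfolding consistent_losses_def consistent_loss_def by blast
  define w where "w = (\<lambda>i. h (g2_hat (z i)))"
  define f where "f = minmax n (\<lambda>i j. T_lower V (weighted_empirical w y i j))"
  define v where "v = (\<lambda>k. L (f k) (y k))"
  define r where "r = (\<lambda>k. - minmax n (\<lambda>i j. - block_mean v i j) k)"
  let ?g1 = "g1_lower V n z y w"
  let ?g2 = "g2_lower L n z y ?g1"
  have g1: "?g1 (z k) = f k" if "k \<in> {1..n}" for k
    using g1_lower_covariate[OF z that] by (simp add: f_def)
  have bm: "block_mean (\<lambda>k. L (?g1 (z k)) (y k)) i j = block_mean v i j" if "1 \<le> i" "j \<le> n" for i j
    unfolding block_mean_def v_def using g1 that by (intro arg_cong2[of _ _ _ _ "(/)"] sum.cong) auto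
  have g2: "?g2 (z k) = r k" if "k \<in> {1..n}" for k
  proof -
    have "(MAX i\<in>{1..j}. - block_mean (\<lambda>k. L (?g1 (z k)) (y k)) i j) = (MAX i\<in>{1..j}. - block_mean v i j)"
      if "j \<le> n" for j
      using bm that by (intro arg_cong[of _ _ Max] image_cong) auto
    then show ?thesis
      unfolding g2_lower_covariate[OF z that] r_def minmax_def
      by (intro arg_cong[of _ _ uminus] arg_cong[of _ _ Min] image_cong) auto
  qed
  have "mono_on {1..n} (\<lambda>k. ereal (g1_hat (z k)))" and "antimono_on {1..n} (\<lambda>k. g2_hat (z k))"
    using assms(7) unfolding is_minimizer_def monotone_on_covariates_iff[OF z] by blast+
  then have hat: "mono_on {1..n} (\<lambda>k. g1_hat (z k))" "antimono_on {1..n} (\<lambda>k. g2_hat (z k))"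
    by (simp_all add: monotone_on_def)
  note opt = minimizer_optimal_on_indices[OF z assms(7)]
  have "total_score h n v r \<le> total_score h n v (\<lambda>k. g2_hat (z k))"
    unfolding r_def by (rule minmax_mean_optimal[OF h hat(2)])
  also have "\<dots> \<le> total_score h n (\<lambda>k. L (ereal (g1_hat (z k))) (y k)) (\<lambda>k. g2_hat (z k))"
  proof -
    have "(\<Sum>k=1..n. w k * L (f k) (y k)) \<le> (\<Sum>k=1..n. w k * L (ereal (g1_hat (z k))) (y k))"
      unfolding f_def
    proof (rule consistent_loss.minmax_T_lower_optimal[OF M _ hat(1)])
      show "0 < w k" for k using h_pos by (simp add: w_def)
      fix k assume k: "k \<in> {1..n}"
      show "integrable M (loss_integrand V (minmax n (\<lambda>i j. T_lower V (weighted_empirical w y i j)) k) (y k))"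
        unfolding w_def
        by (rule consistent_loss.integrable_at_minmax[OF M h_pos h assms(6) hat opt k])
    qed
    then show ?thesis
      by (simp add: total_score_def w_def v_def right_diff_distrib sum.distrib sum_subtractf)
  qed
  finally have le: "total_score h n v r
      \<le> total_score h n (\<lambda>k. L (ereal (g1_hat (z k))) (y k)) (\<lambda>k. g2_hat (z k))" .
  have obj: "objective h L n z y ?g1 ?g2 = total_score h n v r"
    unfolding v_def using g1 g2 by (rule objective_eq_total_score)
  have "is_minimizer h L n z y ?g1 ?g2"
    unfolding is_minimizer_def
  proof (intro conjI allI impI)
    show "mono_on (z ` {1..n}) ?g1"
      unfolding monotone_on_covariates_iff[OF z] using g1 by (auto intro!: mono_onI minmax_mono simp: f_def)
    show "antimono_on (z ` {1..n}) ?g2"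
      unfolding monotone_on_covariates_iff[OF z] using g2
      by (auto intro!: monotone_onI minmax_mono simp: r_def)
    fix f1 f2 :: "'z \<Rightarrow> real"
    assume "mono_on (z ` {1..n}) f1" "antimono_on (z ` {1..n}) f2"
    then have "mono_on {1..n} (\<lambda>k. f1 (z k))" "antimono_on {1..n} (\<lambda>k. f2 (z k))"
      unfolding monotone_on_covariates_iff[OF z] .
    from opt[OF this] le show "objective h L n z y ?g1 ?g2 \<le> objective h L n z y (\<lambda>x. ereal (f1 x)) f2"
      unfolding obj by (simp add: objective_def total_score_def)
  qed
  then show ?thesis unfolding w_def .
qed

end
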